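(* Let $f,g,h,k:\mathbb{Z}\to\mathbb{R}$ satisfy $$f(x)+g(y)\le h\left(\left\lfloor \frac{x+y}{2}\right\rfloor\right)+k\left(\left\lceil\frac{x+y}{2}\right\rceil\right)\qquad\text{for all }x,y\in\mathbb{Z}.$$ Then $$\left(\sum_{x\in\mathbb{Z}}e^{f(x)}\right)\left(\sum_{x\in\mathbb{Z}}e^{g(x)}\right)\le\left(\sum_{x\in\mathbb{Z}}e^{h(x)}\right)\left(\sum_{x\in\mathbb{Z}}e^{k(x)}\right).$$
   Context: $\lfloor x\rfloor$ is the lower integer part (floor) and $\lceil x\rceil$ the upper integer part (ceiling) of $x\in\mathbb{R}$. The sums of positive terms are taken in $(0,+\infty]$. *)

theory Defs
  imports "HOL-Analysis.Analysis"
begin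

end

theory Submission
  imports Defs
begin

text \<open>
  The proof is by monotone transport and entropy.  Write \<open>\<eta> t = - t ln t\<close>.  By the Gibbs
  variational principle, \<open>ln (\<Sum>x. exp (f x))\<close> is the maximum of \<open>\<Sum>x. w x * f x + \<eta> (w x)\<close> over
  probability vectors \<open>w\<close> on a finite set, attained at \<open>w = exp f / \<Sum> exp f\<close>.  Let \<open>u\<close> and \<open>v\<close> be the
  maximisers for \<open>f\<close> and \<open>g\<close> on a common finite interval, and couple them monotonically.  The
  support of the coupling lies on a staircase of unit steps to the right or upwards, so each
  sum \<open>s = x + y\<close> occurs at one point of the staircase only; let \<open>p s\<close> be the mass there.  The
  images of the coupling under the two rounded midpoints have the weights
  \<open>p (2 * z) + p (2 * z + 1)\<close> and \<open>p (2 * z - 1) + p (2 * z)\<close>.  Integrating the hypothesis against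
  the coupling and applying the variational principle to \<open>h\<close> and \<open>k\<close> gives the claim, as soon as
  the entropies of these two images add up to at least those of \<open>u\<close> and \<open>v\<close>.

  This comparison is the heart of the matter.  Together, the two images carry the entropy of all
  sums \<open>p s + p (s + 1)\<close> of neighbours, whereas \<open>u\<close> and \<open>v\<close> carry the entropy of the total masses of
  the horizontal and vertical runs of the staircase.  If the staircase is built one point at a
  time, then a new mass \<open>a\<close> is added to a neighbour \<open>p\<close> in the first case and to a run of mass
  \<open>b \<ge> p\<close> in the second, so that the first entropy grows at least as much because \<open>\<eta>\<close> is concave.
  The passage from finite intervals to all integers is by monotone limits.
\<close>

section \<open>The entropy function\<close>

definition eta :: "real \<Rightarrow> real" where
  "eta t = - (t * ln t)"

lemma eta_0 [simp]: "eta 0 = 0"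
  by (simp add: eta_def)

lemma DERIV_eta:
  assumes "t > 0"
  shows "(eta has_real_derivative - (ln t + 1)) (at t)"
  unfolding eta_def[abs_def] using assms by (auto intro!: derivative_eq_intros)

lemma eta_increment_antimono:
  assumes "0 \<le> p" "p \<le> b" "0 \<le> a"
  shows "eta (b + a) - eta b \<le> eta (p + a) - eta p"
proof (cases "p = 0 \<or> a = 0")
  case True
  \<comment> \<open>The derivative of \<^term>\<open>eta\<close> is infinite at \<open>0\<close>; there the claim is subadditivity, which
    only uses that the logarithm increases.\<close>
  have "b * ln b + a * ln a \<le> b * ln (b + a) + a * ln (b + a)" if "p = 0"
  proof (intro add_mono)
    show "b * ln b \<le> b * ln (b + a)"
      using assms by (cases "b = 0") (auto intro!: mult_left_mono)
    show "a * ln a \<le> a * ln (b + a)"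
      using assms by (cases "a = 0") (auto intro!: mult_left_mono)
  qed
  with True show ?thesis
    by (auto simp: eta_def algebra_simps)
next
  case False
  have "eta (b + a) - eta b \<le> eta (p + a) - eta p"
  proof (rule DERIV_nonpos_imp_nonincreasing[of p b "\<lambda>t. eta (t + a) - eta t"])
    fix t assume t: "p \<le> t" "t \<le> b"
    have "((\<lambda>t. eta (t + a) - eta t) has_real_derivative (ln t - ln (t + a))) (at t)"
      using t False assms
      by (auto intro!: derivative_eq_intros DERIV_chain2[OF DERIV_eta] DERIV_eta)
    moreover have "ln t - ln (t + a) \<le> 0"
      using t False assms by simp
    ultimately show "\<exists>y. ((\<lambda>t. eta (t + a) - eta t) has_real_derivative y) (at t) \<and> y \<le> 0"
      by blast
  qed (use assms in auto)
  then show ?thesis .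
qed

text \<open>
  The two halves of the Gibbs variational principle.  The upper bound is \<open>ln t \<le> t - 1\<close> at the
  ratio \<open>t\<close> of the weights \<open>exp (h z) / Z\<close> and \<open>w z\<close>, averaged with respect to \<open>w\<close>.
\<close>

lemma gibbs_upper_bound:
  fixes h w :: "'a \<Rightarrow> real"
  assumes "finite A" and nonneg: "\<And>z. z \<in> A \<Longrightarrow> 0 \<le> w z" and one: "(\<Sum>z\<in>A. w z) = 1"
  shows "(\<Sum>z\<in>A. w z * h z + eta (w z)) \<le> ln (\<Sum>z\<in>A. exp (h z))"
proof -
  define Z where "Z = (\<Sum>z\<in>A. exp (h z))"
  have "A \<noteq> {}"
    using one by auto
  then have Z: "Z > 0"
    unfolding Z_def using \<open>finite A\<close> by (intro sum_pos) auto
  have "w z * h z + eta (w z) \<le> w z * ln Z + (exp (h z) / Z - w z)" if "z \<in> A" for z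
  proof (cases "w z = 0")
    case True
    then show ?thesis using Z by simp
  next
    case False
    with nonneg[OF that] have w: "w z > 0" by simp
    have "h z - ln Z - ln (w z) = ln (exp (h z) / (Z * w z))"
      using Z w by (simp add: ln_div ln_mult)
    also have "\<dots> \<le> exp (h z) / (Z * w z) - 1"
      using Z w by (intro ln_le_minus_one) simp
    finally have "w z * (h z - ln Z - ln (w z)) \<le> w z * (exp (h z) / (Z * w z) - 1)"
      using w by (intro mult_left_mono) auto
    also have "\<dots> = exp (h z) / Z - w z"
      using w Z by (simp add: field_simps)
    finally show ?thesis
      by (simp add: eta_def algebra_simps)
  qed
  then have "(\<Sum>z\<in>A. w z * h z + eta (w z)) \<le> (\<Sum>z\<in>A. w z * ln Z + (exp (h z) / Z - w z))"
    by (rule sum_mono)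
  also have "\<dots> = ln Z * (\<Sum>z\<in>A. w z) + Z / Z - (\<Sum>z\<in>A. w z)"
    by (simp add: sum.distrib sum_subtractf sum_distrib_left sum_divide_distrib[symmetric]
        Z_def[symmetric] mult.commute)
  also have "\<dots> = ln Z"
    using Z one by simp
  finally show ?thesis
    by (simp add: Z_def)
qed

lemma gibbs_attained:
  fixes f :: "'a \<Rightarrow> real"
  assumes "finite A" "A \<noteq> {}"
  obtains u where "\<And>x. 0 \<le> u x" "(\<Sum>x\<in>A. u x) = 1"
    "(\<Sum>x\<in>A. u x * f x + eta (u x)) = ln (\<Sum>x\<in>A. exp (f x))"
proof
  define Z where "Z = (\<Sum>x\<in>A. exp (f x))"
  have Z: "Z > 0"
    unfolding Z_def using assms by (intro sum_pos) auto
  define u where "u x = exp (f x) / Z" for x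
  show "0 \<le> u x" for x
    using Z by (simp add: u_def)
  show one: "(\<Sum>x\<in>A. u x) = 1"
    using Z by (simp add: u_def sum_divide_distrib[symmetric] Z_def[symmetric])
  have "u x * f x + eta (u x) = u x * ln Z" for x
  proof -
    have "ln (u x) = f x - ln Z"
      using Z by (simp add: u_def ln_div)
    then show ?thesis
      unfolding eta_def by (simp only:) (simp add: algebra_simps)
  qed
  then show "(\<Sum>x\<in>A. u x * f x + eta (u x)) = ln (\<Sum>x\<in>A. exp (f x))"
    using one by (simp add: sum_distrib_right[symmetric] Z_def[symmetric])
qed

section \<open>The monotone coupling\<close>

text \<open>
  The coupling is built from its last point \<open>(m, n)\<close> downwards: this point receives the smaller of
  \<open>u m\<close> and \<open>v n\<close>, which exhausts the last column or the last row, and the rest is a problem with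
  \<open>m + n\<close> smaller by one.  Only the mass \<open>p s\<close> at the point with sum \<open>s\<close> is kept.  The bounds on
  \<open>p (m + n)\<close> make the concavity of \<^term>\<open>eta\<close> applicable in the next step.
\<close>

lemma staircase_coupling:
  fixes u v f g H :: "nat \<Rightarrow> real"
  assumes "\<And>x. 0 \<le> u x" and "\<And>y. 0 \<le> v y"
    and "(\<Sum>x\<le>m. u x) = (\<Sum>y\<le>n. v y)"
    and "\<And>x y. f x + g y \<le> H (x + y)"
  shows "\<exists>p. (\<forall>s. 0 \<le> p s) \<and> (\<Sum>s\<le>m + n. p s) = (\<Sum>x\<le>m. u x) \<and>
           p (m + n) \<le> u m \<and> p (m + n) \<le> v n \<and>
           (\<Sum>x\<le>m. u x * f x + eta (u x)) + (\<Sum>y\<le>n. v y * g y + eta (v y))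
             \<le> (\<Sum>s\<le>m + n. p s * H s)
               + eta (p 0) + (\<Sum>s<m + n. eta (p s + p (Suc s))) + eta (p (m + n))"
  using assms
proof (induction "m + n" arbitrary: m n u v f g)
  case 0
  then have [simp]: "m = 0" "n = 0" and uv: "u 0 = v 0" by simp_all
  have "u 0 * (f 0 + g 0) \<le> u 0 * H 0"
    using 0(5)[of 0 0] 0(2) by (intro mult_left_mono) auto
  then show ?case
    using 0 uv by (intro exI[of _ u]) (auto simp: algebra_simps)
next
  case (Suc N)
  note hyp = Suc.prems
  \<comment> \<open>Up to exchanging the two marginals, the last column is exhausted.\<close>
  have step: "\<exists>p. (\<forall>s. 0 \<le> p s) \<and> (\<Sum>s\<le>Suc N. p s) = (\<Sum>x\<le>Suc m'. u x) \<and>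
           p (Suc N) \<le> u (Suc m') \<and> p (Suc N) \<le> v n' \<and>
           (\<Sum>x\<le>Suc m'. u x * f x + eta (u x)) + (\<Sum>y\<le>n'. v y * g y + eta (v y))
             \<le> (\<Sum>s\<le>Suc N. p s * H s)
               + eta (p 0) + (\<Sum>s<Suc N. eta (p s + p (Suc s))) + eta (p (Suc N))"
    if N: "N = m' + n'" and le: "u (Suc m') \<le> v n'"
      and u: "\<And>x. 0 \<le> u x" and v: "\<And>y. 0 \<le> v y"
      and tot: "(\<Sum>x\<le>Suc m'. u x) = (\<Sum>y\<le>n'. v y)"
      and H: "\<And>x y. f x + g y \<le> H (x + y)"
    for m' n' and u v f g :: "nat \<Rightarrow> real"
  proof -
    define a where "a = u (Suc m')"
    define b where "b = v n' - a"
    define v' where "v' = v(n' := b)"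
    have sum_v: "(\<Sum>y\<le>n'. F y (v y)) = (\<Sum>y\<le>n'. F y (v' y)) - F n' b + F n' (v n')"
      for F :: "nat \<Rightarrow> real \<Rightarrow> real"
      by (cases n') (simp_all add: v'_def)
    have "0 \<le> b"
      using le by (simp add: a_def b_def)
    have v': "0 \<le> v' y" for y
      using v le by (simp add: v'_def b_def a_def)
    have tot': "(\<Sum>x\<le>m'. u x) = (\<Sum>y\<le>n'. v' y)"
      using tot sum_v[of "\<lambda>_ t. t"] by (simp add: a_def b_def)
    obtain q where q: "\<forall>s. 0 \<le> q s" "(\<Sum>s\<le>N. q s) = (\<Sum>x\<le>m'. u x)"
        "q N \<le> v' n'"
        "(\<Sum>x\<le>m'. u x * f x + eta (u x)) + (\<Sum>y\<le>n'. v' y * g y + eta (v' y))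
             \<le> (\<Sum>s\<le>N. q s * H s)
               + eta (q 0) + (\<Sum>s<N. eta (q s + q (Suc s))) + eta (q N)"
      using Suc.hyps(1)[OF N u v' tot' H] by (auto simp: N)
    define p where "p = q(Suc N := a)"
    have sum_le: "(\<Sum>s\<le>N. F s (p s)) = (\<Sum>s\<le>N. F s (q s))" for F :: "nat \<Rightarrow> real \<Rightarrow> real"
      by (intro sum.cong) (auto simp: p_def)
    have sum_less: "(\<Sum>s<N. eta (p s + p (Suc s))) = (\<Sum>s<N. eta (q s + q (Suc s)))"
      by (intro sum.cong) (auto simp: p_def)
    have p_at: "p 0 = q 0" "p N = q N" "p (Suc N) = a"
      by (auto simp: p_def)
    have "q N \<le> b"
      using q(3) by (simp add: v'_def)
    then have conc: "eta (b + a) - eta b \<le> eta (q N + a) - eta (q N)"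
      using q(1) u by (intro eta_increment_antimono) (auto simp: a_def)
    have "a * (f (Suc m') + g n') \<le> a * H (Suc N)"
      using H[of "Suc m'" n'] u by (intro mult_left_mono) (auto simp: a_def N)
    then have gain: "a * f (Suc m') + (b + a) * g n' - b * g n' \<le> a * H (Suc N)"
      by (simp add: algebra_simps)
    have vn: "v n' = b + a"
      by (simp add: b_def)
    have "(\<Sum>x\<le>Suc m'. u x * f x + eta (u x)) + (\<Sum>y\<le>n'. v y * g y + eta (v y))
        = (\<Sum>x\<le>m'. u x * f x + eta (u x)) + (\<Sum>y\<le>n'. v' y * g y + eta (v' y))
          + (a * f (Suc m') + (b + a) * g n' - b * g n') + (eta (b + a) - eta b) + eta a"
      using sum_v[of "\<lambda>y t. t * g y + eta t"] by (simp add: vn a_def[symmetric])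
    also have "\<dots> \<le> (\<Sum>s\<le>N. q s * H s) + eta (q 0)
          + (\<Sum>s<N. eta (q s + q (Suc s))) + eta (q N)
          + a * H (Suc N) + (eta (q N + a) - eta (q N)) + eta a"
      using q(4) conc gain by linarith
    also have "\<dots> = (\<Sum>s\<le>Suc N. p s * H s)
          + eta (p 0) + (\<Sum>s<Suc N. eta (p s + p (Suc s))) + eta (p (Suc N))"
      using sum_le[of "\<lambda>s t. t * H s"] sum_less by (simp add: p_at)
    finally have main: "(\<Sum>x\<le>Suc m'. u x * f x + eta (u x)) + (\<Sum>y\<le>n'. v y * g y + eta (v y))
        \<le> (\<Sum>s\<le>Suc N. p s * H s)
          + eta (p 0) + (\<Sum>s<Suc N. eta (p s + p (Suc s))) + eta (p (Suc N))" .
    have "\<forall>s. 0 \<le> p s"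
      using q(1) u by (auto simp: p_def a_def)
    moreover have "(\<Sum>s\<le>Suc N. p s) = (\<Sum>x\<le>Suc m'. u x)"
      using sum_le[of "\<lambda>s t. t"] q(2) by (simp add: p_at a_def)
    moreover have "p (Suc N) \<le> u (Suc m')" "p (Suc N) \<le> v n'"
      using le by (auto simp: p_at a_def)
    ultimately show ?thesis
      using main by blast
  qed
  \<comment> \<open>A marginal that lives on a single point has the larger last entry, being equal to the
    total mass there.\<close>
  have "(\<exists>m'. m = Suc m' \<and> u m \<le> v n) \<or> (\<exists>n'. n = Suc n' \<and> v n \<le> u m)"
  proof (cases m)
    case m: 0
    then obtain n' where "n = Suc n'"
      using Suc.hyps(2) by (cases n) auto
    moreover have "v n \<le> (\<Sum>y\<le>n. v y)"
      using hyp(2) by (intro member_le_sum) auto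
    ultimately show ?thesis
      using hyp(3) m by auto
  next
    case m: (Suc m')
    show ?thesis
    proof (cases n)
      case 0
      have "u m \<le> (\<Sum>x\<le>m. u x)"
        using hyp(1) by (intro member_le_sum) auto
      then show ?thesis
        using hyp(3) m 0 by auto
    next
      case (Suc n')
      then show ?thesis using m by (cases "u m \<le> v n") auto
    qed
  qed
  then consider (col) m' where "m = Suc m'" "u m \<le> v n" | (row) n' where "n = Suc n'" "v n \<le> u m"
    by blast
  then show ?case
  proof cases
    case col
    then show ?thesis
      using step[of m' n u v f g] hyp Suc.hyps(2) by simp
  next
    case row
    have "g y + f x \<le> H (y + x)" for x y
      using hyp(4)[of x y] by (simp add: add.commute)
    then have "\<exists>p. (\<forall>s. 0 \<le> p s) \<and> (\<Sum>s\<le>Suc N. p s) = (\<Sum>y\<le>n. v y) \<and>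
           p (Suc N) \<le> v n \<and> p (Suc N) \<le> u m \<and>
           (\<Sum>y\<le>n. v y * g y + eta (v y)) + (\<Sum>x\<le>m. u x * f x + eta (u x))
             \<le> (\<Sum>s\<le>Suc N. p s * H s)
               + eta (p 0) + (\<Sum>s<Suc N. eta (p s + p (Suc s))) + eta (p (Suc N))"
      using step[of n' m v u g f] hyp(1-3) Suc.hyps(2) row by simp
    then show ?thesis
      using hyp(3) by (auto simp: Suc.hyps(2)[symmetric] add.commute)
  qed
qed

section \<open>The inequality on a finite interval\<close>

lemma sum_pairs_from_0:
  fixes F :: "nat \<Rightarrow> real"
  shows "(\<Sum>s\<le>2 * K. F s) = (\<Sum>z<K. F (2 * z) + F (2 * z + 1)) + F (2 * K)"
  by (induction K) simp_all

lemma sum_pairs_from_1: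
  fixes F :: "nat \<Rightarrow> real"
  shows "(\<Sum>s\<le>2 * K. F s) = F 0 + (\<Sum>z<K. F (2 * z + 1) + F (2 * z + 2))"
  by (induction K) simp_all

text \<open>
  Both midpoints of two points of the interval lie in the interval again, so all four sums can be
  cut off at the same place.
\<close>

lemma finite_midpoint_inequality:
  fixes f g h k :: "nat \<Rightarrow> real"
  assumes mid: "\<And>x y. f x + g y \<le> h ((x + y) div 2) + k ((x + y + 1) div 2)"
  shows "(\<Sum>x\<le>K. exp (f x)) * (\<Sum>y\<le>K. exp (g y)) \<le> (\<Sum>z\<le>K. exp (h z)) * (\<Sum>z\<le>K. exp (k z))"
proof -
  obtain u where u: "\<And>x. 0 \<le> u x" "(\<Sum>x\<le>K. u x) = 1"
    "(\<Sum>x\<le>K. u x * f x + eta (u x)) = ln (\<Sum>x\<le>K. exp (f x))"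
    using gibbs_attained[of "{..K}" f] by auto
  obtain v where v: "\<And>x. 0 \<le> v x" "(\<Sum>x\<le>K. v x) = 1"
    "(\<Sum>x\<le>K. v x * g x + eta (v x)) = ln (\<Sum>x\<le>K. exp (g x))"
    using gibbs_attained[of "{..K}" g] by auto
  define H where "H s = h (s div 2) + k ((s + 1) div 2)" for s
  have "\<exists>p. (\<forall>s. 0 \<le> p s) \<and> (\<Sum>s\<le>K + K. p s) = (\<Sum>x\<le>K. u x) \<and>
           p (K + K) \<le> u K \<and> p (K + K) \<le> v K \<and>
           (\<Sum>x\<le>K. u x * f x + eta (u x)) + (\<Sum>y\<le>K. v y * g y + eta (v y))
             \<le> (\<Sum>s\<le>K + K. p s * H s)
               + eta (p 0) + (\<Sum>s<K + K. eta (p s + p (Suc s))) + eta (p (K + K))"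
    using u v mid by (intro staircase_coupling) (auto simp: H_def)
  then obtain p where p: "\<And>s. 0 \<le> p s" "(\<Sum>s\<le>2 * K. p s) = 1"
    and ent: "ln (\<Sum>x\<le>K. exp (f x)) + ln (\<Sum>y\<le>K. exp (g y))
             \<le> (\<Sum>s\<le>2 * K. p s * H s)
               + eta (p 0) + (\<Sum>s<2 * K. eta (p s + p (Suc s))) + eta (p (2 * K))"
    using u v by (auto simp: mult_2)
  \<comment> \<open>The distributions of the lower and of the upper midpoint; \<open>p\<close> counts as zero
    outside the range from \<open>0\<close> to \<open>2 * K\<close>.\<close>
  define w where "w z = p (2 * z) + (if z < K then p (2 * z + 1) else 0)" for z
  define w' where "w' z = (if z = 0 then 0 else p (2 * z - 1)) + p (2 * z)" for z
  have sum_w: "(\<Sum>z\<le>K. F z (w z)) = (\<Sum>z<K. F z (p (2 * z) + p (2 * z + 1))) + F K (p (2 * K))"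
    for F :: "nat \<Rightarrow> real \<Rightarrow> real"
    by (simp add: lessThan_Suc_atMost[symmetric] w_def)
  have sum_w': "(\<Sum>z\<le>K. F z (w' z)) = F 0 (p 0) + (\<Sum>z<K. F (Suc z) (p (2 * z + 1) + p (2 * z + 2)))"
    for F :: "nat \<Rightarrow> real \<Rightarrow> real"
    by (simp add: lessThan_Suc_atMost[symmetric] sum.lessThan_Suc_shift w'_def del: sum.lessThan_Suc)
  have w1: "(\<Sum>z\<le>K. w z) = 1" and w'1: "(\<Sum>z\<le>K. w' z) = 1"
    using p(2) sum_w[of "\<lambda>_ t. t"] sum_w'[of "\<lambda>_ t. t"]
    by (simp_all only: sum_pairs_from_0[of p K] sum_pairs_from_1[of p K, symmetric])
  have "(\<Sum>s\<le>2 * K. p s * H s)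
      = (\<Sum>s\<le>2 * K. p s * h (s div 2)) + (\<Sum>s\<le>2 * K. p s * k ((s + 1) div 2))"
    by (simp add: H_def algebra_simps sum.distrib)
  also have "(\<Sum>s\<le>2 * K. p s * h (s div 2)) = (\<Sum>z\<le>K. w z * h z)"
    unfolding sum_pairs_from_0[of _ K] sum_w[of "\<lambda>z t. t * h z"] by (simp add: distrib_right)
  also have "(\<Sum>s\<le>2 * K. p s * k ((s + 1) div 2)) = (\<Sum>z\<le>K. w' z * k z)"
    unfolding sum_pairs_from_1[of _ K] sum_w'[of "\<lambda>z t. t * k z"] by (simp add: distrib_right)
  finally have cost: "(\<Sum>s\<le>2 * K. p s * H s) = (\<Sum>z\<le>K. w z * h z) + (\<Sum>z\<le>K. w' z * k z)" .
  have neighbours: "(\<Sum>s<2 * J. eta (p s + p (Suc s)))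
      = (\<Sum>z<J. eta (p (2 * z) + p (2 * z + 1))) + (\<Sum>z<J. eta (p (2 * z + 1) + p (2 * z + 2)))" for J
    by (induction J) simp_all
  have "eta (p 0) + (\<Sum>s<2 * K. eta (p s + p (Suc s))) + eta (p (2 * K))
      = (\<Sum>z\<le>K. eta (w z)) + (\<Sum>z\<le>K. eta (w' z))"
    using sum_w[of "\<lambda>_. eta"] sum_w'[of "\<lambda>_. eta"] neighbours[of K] by linarith
  with ent cost have "ln (\<Sum>x\<le>K. exp (f x)) + ln (\<Sum>y\<le>K. exp (g y))
      \<le> (\<Sum>z\<le>K. w z * h z + eta (w z)) + (\<Sum>z\<le>K. w' z * k z + eta (w' z))"
    by (simp add: sum.distrib)
  also have "\<dots> \<le> ln (\<Sum>z\<le>K. exp (h z)) + ln (\<Sum>z\<le>K. exp (k z))"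
    using p(1) w1 w'1 by (intro add_mono gibbs_upper_bound) (auto simp: w_def w'_def)
  finally have le: "ln (\<Sum>x\<le>K. exp (f x)) + ln (\<Sum>y\<le>K. exp (g y))
      \<le> ln (\<Sum>z\<le>K. exp (h z)) + ln (\<Sum>z\<le>K. exp (k z))" .
  have pos: "0 < (\<Sum>x\<le>K. exp (F x))" for F :: "nat \<Rightarrow> real"
    by (intro sum_pos) auto
  show ?thesis
    using le by (simp add: ln_mult_pos[OF pos pos, symmetric] ln_le_cancel_iff pos)
qed

section \<open>Passage to all integers\<close>

lemma sum_symmetric_interval:
  fixes F :: "int \<Rightarrow> real"
  shows "(\<Sum>x\<in>{- int N..int N}. F x) = (\<Sum>i\<le>2 * N. F (int i - int N))"
  by (rule sum.reindex_bij_witness[of _ "\<lambda>i. int i - int N" "\<lambda>x. nat (x + int N)"]) auto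

lemma infsum_int_eq_SUP:
  fixes F :: "int \<Rightarrow> ennreal"
  shows "(\<Sum>\<^sub>\<infinity>x. F x) = (SUP N. \<Sum>x\<in>{- int N..int N}. F x)"
proof -
  have "(\<Sum>\<^sub>\<infinity>x. F x) = (SUP A\<in>{A. finite A}. sum F A)"
    by (simp add: nonneg_infsum_complete)
  also have "\<dots> = (SUP N. \<Sum>x\<in>{- int N..int N}. F x)"
  proof (rule antisym)
    show "(SUP A\<in>{A. finite A}. sum F A) \<le> (SUP N. \<Sum>x\<in>{- int N..int N}. F x)"
    proof (rule SUP_mono)
      fix A :: "int set" assume "A \<in> {A. finite A}"
      then have fin: "finite A" by simp
      \<comment> \<open>Any bound for the absolute values would do; the sum also covers the empty set.\<close>
      define N where "N = (\<Sum>x\<in>A. nat \<bar>x\<bar>)"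
      have "nat \<bar>x\<bar> \<le> N" if "x \<in> A" for x
        unfolding N_def using that fin by (intro member_le_sum) auto
      then have "A \<subseteq> {- int N..int N}"
        by force
      then show "\<exists>N\<in>UNIV. sum F A \<le> (\<Sum>x\<in>{- int N..int N}. F x)"
        by (intro bexI[of _ N] sum_mono2) auto
    qed
  qed (auto intro!: SUP_mono)
  finally show ?thesis .
qed

theorem theorem1p4:
  fixes f g h k :: "int \<Rightarrow> real"
  assumes "\<And>x y :: int. f x + g y
             \<le> h \<lfloor>real_of_int (x + y) / 2\<rfloor> + k \<lceil>real_of_int (x + y) / 2\<rceil>"
  shows "(\<Sum>\<^sub>\<infinity>x\<in>(UNIV :: int set). ennreal (exp (f x))) * (\<Sum>\<^sub>\<infinity>x\<in>(UNIV :: int set). ennreal (exp (g x)))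
       \<le> (\<Sum>\<^sub>\<infinity>x\<in>(UNIV :: int set). ennreal (exp (h x))) * (\<Sum>\<^sub>\<infinity>x\<in>(UNIV :: int set). ennreal (exp (k x)))"
proof -
  define S where "S F N = (\<Sum>x\<in>{- int N..int N}. ennreal (exp (F x)))" for F :: "int \<Rightarrow> real" and N
  have S_eq: "S F N = ennreal (\<Sum>i\<le>2 * N. exp (F (int i - int N)))" for F N
    by (simp add: S_def sum_symmetric_interval sum_ennreal)
  have S_mono: "S F M \<le> S F N" if "M \<le> N" for F M N
    unfolding S_def using that by (intro sum_mono2) auto
  have infsum_eq: "(\<Sum>\<^sub>\<infinity>x. ennreal (exp (F x))) = (SUP N. S F N)" for F
    by (simp add: S_def infsum_int_eq_SUP)
  have finite_case: "S f N * S g N \<le> S h N * S k N" for N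
  proof -
    let ?sh = "\<lambda>(F :: int \<Rightarrow> real) i. F (int i - int N)"
    have "?sh f x + ?sh g y \<le> ?sh h ((x + y) div 2) + ?sh k ((x + y + 1) div 2)" for x y
    proof -
      have eq: "real_of_int (int x - int N + (int y - int N)) / 2
          = real_of_int (int (x + y)) / 2 + real_of_int (- int N)"
        by (simp add: field_simps)
      have "\<lfloor>real_of_int (int (x + y)) / 2\<rfloor> = int ((x + y) div 2)"
        by (metis floor_divide_of_int_eq of_int_numeral of_nat_numeral zdiv_int)
      moreover have "\<lceil>real_of_int (int (x + y)) / 2\<rceil> = int ((x + y + 1) div 2)"
        using ceiling_divide_eq_div[of "int (x + y)" 2, where ?'a = real] by simp
      ultimately show ?thesis
        using assms[of "int x - int N" "int y - int N"] unfolding eq floor_add_int[symmetric]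
          ceiling_add_of_int by simp
    qed
    from finite_midpoint_inequality[of "?sh f" "?sh g" "?sh h" "?sh k" "2 * N", OF this] show ?thesis
      by (simp add: S_eq ennreal_mult[symmetric] sum_nonneg ennreal_leI)
  qed
  have "S f M * S g N \<le> (SUP N. S h N) * (SUP N. S k N)" for M N
  proof -
    have "S f M * S g N \<le> S f (max M N) * S g (max M N)"
      by (intro mult_mono S_mono) auto
    also have "\<dots> \<le> S h (max M N) * S k (max M N)"
      by (rule finite_case)
    also have "\<dots> \<le> (SUP N. S h N) * (SUP N. S k N)"
      by (intro mult_mono SUP_upper) auto
    finally show ?thesis .
  qed
  then have "(SUP M. S f M) * (SUP N. S g N) \<le> (SUP N. S h N) * (SUP N. S k N)"
    by (simp add: SUP_mult_left_ennreal SUP_mult_right_ennreal SUP_le_iff)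
  then show ?thesis
    by (simp add: infsum_eq)
qed

end
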